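(* Let $m\ge2$ and $\tau\in S_m$. For a pattern $\tau$, let $\Xi(\tau)$ be the set of positive integers $r$ such that for some $n\ge1$ there is a permutation $\pi\in S_n$ of order $r$ (in the group $S_n$) all of whose powers $\pi^j$, $j\ge1$, avoid $\tau$. Then: (i) if $\tau=12\cdots m$ is the identity, $\Xi(\tau)$ equals the set of orders of elements of $S_{m-1}$; (ii) if $\tau\notin\{12\cdots m,\ m12\cdots(m-1),\ 23\cdots m1\}$, then $\Xi(\tau)=\mathbb N$; (iii) $\Xi(231)=\Xi(312)=\{1,2\}$.
   Context: Permutations $\pi\in S_n$ are identified with words $\pi(1)\cdots\pi(n)$. For $\tau\in S_m$, entries $\pi(i_1),\ldots,\pi(i_m)$ with $i_1<\cdots<i_m$ form an occurrence of $\tau$ if for all $j,l$, $\pi(i_j)<\pi(i_l)$ iff $\tau(j)<\tau(l)$; $\pi$ avoids $\tau$ if there is no occurrence. Here $m12\cdots(m-1)$ denotes the word $m,1,2,\ldots,m-1$ and $23\cdots m1$ the word $2,3,\ldots,m,1$. *)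

theory Defs
  imports "HOL-Algebra.Sym_Groups" "HOL-Algebra.Multiplicative_Group"
begin

text \<open>
  The permutation whose one-line notation is \<open>w\<close>. Positions are numbered from 1, and the
  function is the identity outside \<open>{1..length w}\<close>, as required of elements of \<open>sym_group\<close>.
\<close>
definition of_word :: "nat list \<Rightarrow> nat \<Rightarrow> nat" where
  "of_word w = (\<lambda>i. if i \<in> {1..length w} then w ! (i - 1) else i)"

definition occurrence :: "nat \<Rightarrow> (nat \<Rightarrow> nat) \<Rightarrow> nat \<Rightarrow> (nat \<Rightarrow> nat) \<Rightarrow> (nat \<Rightarrow> nat) \<Rightarrow> bool" where
  "occurrence n \<pi> m \<tau> i \<longleftrightarrow>
     i ` {1..m} \<subseteq> {1..n} \<and> strict_mono_on {1..m} i \<and>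
     (\<forall>j\<in>{1..m}. \<forall>l\<in>{1..m}. \<pi> (i j) < \<pi> (i l) \<longleftrightarrow> \<tau> j < \<tau> l)"

definition avoids :: "nat \<Rightarrow> (nat \<Rightarrow> nat) \<Rightarrow> nat \<Rightarrow> (nat \<Rightarrow> nat) \<Rightarrow> bool" where
  "avoids n \<pi> m \<tau> \<longleftrightarrow> \<not> (\<exists>i. occurrence n \<pi> m \<tau> i)"

definition Xi :: "nat \<Rightarrow> (nat \<Rightarrow> nat) \<Rightarrow> nat set" where
  "Xi m \<tau> = {r. r > 0 \<and> (\<exists>n\<ge>1. \<exists>\<pi>\<in>carrier (sym_group n).
     group.ord (sym_group n) \<pi> = r \<and>
     (\<forall>j::nat. j \<ge> 1 \<longrightarrow> avoids n (\<pi> [^]\<^bsub>sym_group n\<^esub> j) m \<tau>))}"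

lemma of_word_in_sym_group:
  assumes "distinct w" and "set w = {1..length w}"
  shows "of_word w \<in> carrier (sym_group (length w))"
proof -
  have "bij_betw (\<lambda>i. i - 1) {1..length w} {..<length w}"
    by (rule bij_betwI[where g = Suc]) auto
  moreover have "bij_betw ((!) w) {..<length w} {1..length w}"
    using bij_betw_nth[OF assms(1) refl assms(2)[symmetric]] by simp
  ultimately have "bij_betw ((!) w \<circ> (\<lambda>i. i - 1)) {1..length w} {1..length w}"
    by (rule bij_betw_trans)
  then have "bij_betw (of_word w) {1..length w} {1..length w}"
    by (rule bij_betw_cong[THEN iffD1, rotated]) (simp add: of_word_def)
  then have "of_word w permutes {1..length w}"
    by (rule bij_imp_permutes) (auto simp: of_word_def)
  then show ?thesis by (simp add: sym_group_carrier)
qed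

lemma of_word_upt: "of_word [1..<m + 1] = id"
  by (auto simp: of_word_def fun_eq_iff simp del: upt_Suc)

end

theory Submission
  imports Defs
begin

text \<open>
  (i) A power of \<open>\<pi>\<close> is the identity of \<open>S\<^sub>n\<close>, which avoids \<open>12\<dots>m\<close> only if \<open>n < m\<close>.

  (ii) Every power of the rotation \<open>23\<dots>r1\<close> is a rotation, so it contains \<open>\<tau>\<close> only if \<open>\<tau>\<close> itself
  is a rotation \<open>(k+1)\<dots>m1\<dots>k\<close>. If \<open>\<tau>\<close> is a rotation outside the three exceptional ones, then it
  contains 3412. All powers of the \<open>r\<close>-cycle \<open>(1 2 \<dots> h r (r-1) \<dots> (h+1))\<close> with \<open>h = \<lfloor>r/2\<rfloor>\<close> avoid
  3412: each is a union of an increasing sequence (points staying in their half \<open>{1..h}\<close> or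
  \<open>{h+1..r}\<close>) and a decreasing one (points changing halves).

  (iii) If all powers of \<open>\<pi>\<close> avoid 231, then \<open>\<pi>\<close> also avoids 312, since its inverse is a power.
  If moreover \<open>\<pi> a = b > a\<close> and \<open>\<pi> c = a < c\<close>, then avoidance of both patterns forces \<open>\<pi>\<close> to map the
  interval \<open>(a, c)\<close> onto \<open>(a, b)\<close>, so \<open>b = c\<close>. Applied to the minimum \<open>a\<close> of each cycle this shows
  that \<open>\<pi>\<close> is an involution.
\<close>

section \<open>Orders and powers in the symmetric group\<close>

lemma sym_group_pow: "\<pi> [^]\<^bsub>sym_group n\<^esub> (k::nat) = \<pi> ^^ k"
  by (induction k) (simp_all add: sym_group_def nat_pow_def funpow_Suc_right del: funpow.simps)

lemma ord_sym_group_eq_iff: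
  assumes "\<pi> permutes {1..n}"
  shows "group.ord (sym_group n) \<pi> = d \<longleftrightarrow> (\<forall>k. \<pi> ^^ k = id \<longleftrightarrow> d dvd k)"
  using group.ord_unique[OF sym_group_is_group, of \<pi> n d] assms
  by (simp add: sym_group_carrier sym_group_pow sym_group_one)

lemma ord_sym_group_pos:
  assumes "\<pi> permutes {1..n}"
  shows "group.ord (sym_group n) \<pi> > 0"
proof -
  have "finite (carrier (sym_group n))"
    by (simp add: sym_group_def finite_permutations)
  then show ?thesis
    using group.ord_ge_1[OF sym_group_is_group, of n \<pi>] assms by (simp add: sym_group_carrier)
qed

lemma funpow_ord_sym_group:
  assumes "\<pi> permutes {1..n}"
  shows "\<pi> ^^ group.ord (sym_group n) \<pi> = id"
  using ord_sym_group_eq_iff[OF assms, of "group.ord (sym_group n) \<pi>"] by simp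

text \<open>The order is determined by which powers of the function equal \<open>id\<close>, a
  condition that does not mention the degree of the symmetric group.\<close>

lemma ord_sym_group_mono:
  assumes "\<pi> permutes {1..n}" "n \<le> N"
  shows "group.ord (sym_group N) \<pi> = group.ord (sym_group n) \<pi>"
proof -
  have "\<pi> permutes {1..N}"
    using assms by (auto intro: permutes_subset)
  then show ?thesis
    using ord_sym_group_eq_iff[OF assms(1), of "group.ord (sym_group n) \<pi>"]
    by (subst ord_sym_group_eq_iff) simp_all
qed

text \<open>The clause \<open>r > 0\<close> disappears because every element of a finite group has
  positive order.\<close>

lemma Xi_iff:
  "r \<in> Xi m \<tau> \<longleftrightarrow> (\<exists>n\<ge>1. \<exists>\<pi>. \<pi> permutes {1..n} \<and> group.ord (sym_group n) \<pi> = r \<and>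
     (\<forall>j\<ge>1. avoids n (\<pi> ^^ j) m \<tau>))"
  unfolding Xi_def sym_group_pow mem_Collect_eq Bex_def sym_group_carrier
  using ord_sym_group_pos by blast

section \<open>The pattern 12...m\<close>

lemma avoids_longer:
  assumes "n < m"
  shows "avoids n \<pi> m \<tau>"
  unfolding avoids_def occurrence_def
proof (safe)
  fix i :: "nat \<Rightarrow> nat"
  assume i: "i ` {1..m} \<subseteq> {1..n}" "strict_mono_on {1..m} i"
  have "card {1..m} \<le> card {1..n}"
    using card_inj_on_le[OF strict_mono_on_imp_inj_on[OF i(2)] i(1)] by simp
  with assms show False by simp
qed

lemma not_avoids_id:
  assumes "m \<le> n"
  shows "\<not> avoids n id m id"
  unfolding avoids_def occurrence_def
  using assms by (auto intro!: exI[of _ id] simp: strict_mono_on_def)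

lemma Xi_id:
  assumes "m \<ge> 2"
  shows "Xi m id = group.ord (sym_group (m - 1)) ` carrier (sym_group (m - 1))"
proof (intro equalityI subsetI)
  fix r assume "r \<in> Xi m id"
  then obtain n \<pi> where \<pi>: "\<pi> permutes {1..n}" "group.ord (sym_group n) \<pi> = r"
      "\<forall>j\<ge>1. avoids n (\<pi> ^^ j) m id"
    by (auto simp: Xi_iff)
  \<comment> \<open>The identity is itself one of the powers under consideration: the exponent is
    the order of \<open>\<pi>\<close>, which is at least 1.\<close>
  have "avoids n id m id"
    using \<pi> funpow_ord_sym_group[OF \<pi>(1)] ord_sym_group_pos[OF \<pi>(1)] by (metis Suc_leI One_nat_def)
  then have n: "n \<le> m - 1"
    using not_avoids_id[of m n] by linarith
  have "\<pi> permutes {1..m - 1}"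
    using \<pi>(1) n by (auto intro: permutes_subset)
  then show "r \<in> group.ord (sym_group (m - 1)) ` carrier (sym_group (m - 1))"
    using ord_sym_group_mono[OF \<pi>(1) n] \<pi>(2) by (auto simp: sym_group_carrier)
next
  fix r assume "r \<in> group.ord (sym_group (m - 1)) ` carrier (sym_group (m - 1))"
  then show "r \<in> Xi m id"
    using assms avoids_longer[of "m - 1" m]
    by (auto simp: Xi_iff sym_group_carrier intro!: exI[of _ "m - 1"])
qed

section \<open>Cycles given by a circular arrangement of the points\<close>

text \<open>The witness is the r-cycle (f 0, f 1, ..., f (r-1)). Its powers shift indices modulo r,
  so avoidance has to be checked only for the shifts \<open>k < r\<close>.\<close>

lemma cyclic_arrangement_in_Xi:
  fixes f :: "nat \<Rightarrow> nat"
  assumes "r > 0" and f: "bij_betw f {..<r} {1..r}"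
    and avoid: "\<And>k \<sigma>. k < r \<Longrightarrow> (\<And>i. i < r \<Longrightarrow> \<sigma> (f i) = f ((i + k) mod r)) \<Longrightarrow> avoids r \<sigma> m \<tau>"
  shows "r \<in> Xi m \<tau>"
proof -
  define g where "g = inv_into {..<r} f"
  define \<pi> where "\<pi> p = (if p \<in> {1..r} then f ((g p + 1) mod r) else p)" for p
  have gf: "g (f i) = i" if "i < r" for i
    using f that by (simp add: g_def bij_betw_inv_into_left)
  have fin: "f i \<in> {1..r}" if "i < r" for i
    using f that by (auto simp: bij_betw_def)
  have \<pi>f: "\<pi> (f i) = f ((i + 1) mod r)" if "i < r" for i
    using fin[OF that] gf[OF that] by (simp add: \<pi>_def)
  have pow: "(\<pi> ^^ k) (f i) = f ((i + k) mod r)" if "i < r" for i k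
    using that \<open>r > 0\<close> by (induction k) (simp_all add: \<pi>f mod_Suc_eq)
  have surj: "\<exists>i<r. p = f i" if "p \<in> {1..r}" for p
    using f that by (auto simp: bij_betw_def)
  have id_out: "(\<pi> ^^ k) p = p" if "p \<notin> {1..r}" for k p
    using that by (induction k) (auto simp: \<pi>_def)
  have pow_r: "\<pi> ^^ r = id"
  proof
    fix p show "(\<pi> ^^ r) p = id p"
      using surj[of p] id_out[of p r] pow[of _ r] by (cases "p \<in> {1..r}") auto
  qed
  have \<pi>: "\<pi> permutes {1..r}"
  proof (rule bij_imp_permutes)
    show "bij_betw \<pi> {1..r} {1..r}"
    proof (rule bij_betw_imageI)
      \<comment> \<open>A left inverse yields injectivity, and finiteness then yields
        surjectivity.\<close>
      have "\<pi> ^^ (r - 1) \<circ> \<pi> = id"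
        using pow_r \<open>r > 0\<close> by (metis Suc_diff_1 funpow_Suc_right)
      then show inj: "inj_on \<pi> {1..r}"
        by (metis comp_apply id_apply inj_onI)
      have "\<pi> ` {1..r} \<subseteq> {1..r}"
        using surj \<pi>f fin \<open>r > 0\<close> by (metis image_subsetI mod_less_divisor)
      then show "\<pi> ` {1..r} = {1..r}"
        using inj by (simp add: endo_inj_surj)
    qed
  qed (auto simp: \<pi>_def)
  have "\<pi> ^^ k = id \<longleftrightarrow> r dvd k" for k
  proof
    assume "\<pi> ^^ k = id"
    \<comment> \<open>Following the single point \<open>f 0\<close> already detects whether r
      divides k.\<close>
    then have "f (k mod r) = f 0"
      using pow[OF \<open>r > 0\<close>, of k] by simp
    then have "k mod r = 0"
      using gf \<open>r > 0\<close> by (metis mod_less_divisor)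
    then show "r dvd k" by auto
  next
    assume "r dvd k"
    then obtain q where "k = r * q" by auto
    then show "\<pi> ^^ k = id"
      by (simp add: funpow_mult[symmetric] pow_r)
  qed
  then have "group.ord (sym_group r) \<pi> = r"
    using ord_sym_group_eq_iff[OF \<pi>] by blast
  moreover have "avoids r (\<pi> ^^ j) m \<tau>" for j
    using \<open>r > 0\<close> by (intro avoid[of "j mod r"]) (auto simp: pow mod_add_right_eq)
  ultimately show ?thesis
    using \<pi> \<open>r > 0\<close> by (auto simp: Xi_iff intro!: exI[of _ r] exI[of _ \<pi>])
qed

section \<open>Avoiding 3412 with a folded cycle\<close>

text \<open>With h = \<open>r div 2\<close>, indices 0, ..., h-1 climb through 1, ..., h, and
  indices h, ..., r-1 descend from r to h+1.\<close>

definition fold_back :: "nat \<Rightarrow> nat \<Rightarrow> nat" where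
  "fold_back r i = (if i < r div 2 then Suc i else r + r div 2 - i)"

lemma bij_betw_fold_back: "bij_betw (fold_back r) {..<r} {1..r}"
proof (rule bij_betwI)
  let ?g = "\<lambda>p. if p \<le> r div 2 then p - 1 else r + r div 2 - p"
  show "fold_back r \<in> {..<r} \<rightarrow> {1..r}" "?g \<in> {1..r} \<rightarrow> {..<r}"
    by (auto simp: fold_back_def)
  show "?g (fold_back r i) = i" if "i \<in> {..<r}" for i
    using that by (auto simp: fold_back_def)
  show "fold_back r (?g p) = p" if "p \<in> {1..r}" for p
    using that by (auto simp: fold_back_def)
qed

text \<open>Points from different halves keep their order because each stays in its half. Within one
  half, the halves are too short for one staying index to wrap around and another not to; hence the
  order of indices is kept, and \<open>fold_back\<close> is monotone on each half.\<close>

lemma fold_back_shift_increasing: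
  fixes i j k r :: nat
  defines "i' \<equiv> (i + k) mod r" and "j' \<equiv> (j + k) mod r"
  assumes "i < r" "j < r" "k < r"
    and "i < r div 2 \<longleftrightarrow> i' < r div 2" "j < r div 2 \<longleftrightarrow> j' < r div 2"
    and "fold_back r i < fold_back r j"
  shows "fold_back r i' < fold_back r j'"
proof -
  have "i' = (if i + k < r then i + k else i + k - r)"
    and "j' = (if j + k < r then j + k else j + k - r)"
    using assms(3-5) by (simp_all add: i'_def j'_def mod_if)
  \<comment> \<open>Replacing \<open>r div 2\<close> by h with r = 2h or r = 2h+1 leaves only linear
    arithmetic.\<close>
  moreover obtain h where "r div 2 = h" "r = 2 * h \<or> r = 2 * h + 1"
    by (cases "even r") (auto elim: evenE oddE)
  ultimately show ?thesis
    using assms(3-) unfolding fold_back_def by (simp split: if_splits; linarith)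
qed

text \<open>Points from different halves trade sides. Points leaving the lower half never wrap and
  those leaving the upper half always do, so the order of indices within a half is kept;
  \<open>fold_back\<close> increases on one half and decreases on the other, which reverses the
  values.\<close>

lemma fold_back_shift_decreasing:
  fixes i j k r :: nat
  defines "i' \<equiv> (i + k) mod r" and "j' \<equiv> (j + k) mod r"
  assumes "i < r" "j < r" "k < r"
    and "i < r div 2 \<longleftrightarrow> \<not> i' < r div 2" "j < r div 2 \<longleftrightarrow> \<not> j' < r div 2"
    and "fold_back r i < fold_back r j"
  shows "fold_back r j' < fold_back r i'"
proof -
  have "i' = (if i + k < r then i + k else i + k - r)"
    and "j' = (if j + k < r then j + k else j + k - r)"
    using assms(3-5) by (simp_all add: i'_def j'_def mod_if)
  moreover obtain h where "r div 2 = h" "r = 2 * h \<or> r = 2 * h + 1"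
    by (cases "even r") (auto elim: evenE oddE)
  ultimately show ?thesis
    using assms(3-) unfolding fold_back_def by (simp split: if_splits; linarith)
qed

lemma occurrence_in_range:
  assumes "occurrence n \<pi> m \<tau> i" "a \<in> {1..m}"
  shows "i a \<in> {1..n}"
  using assms by (auto simp: occurrence_def image_subset_iff)

lemma occurrence_less:
  assumes "occurrence n \<pi> m \<tau> i" "a \<in> {1..m}" "b \<in> {1..m}"
  shows "a < b \<Longrightarrow> i a < i b" "\<pi> (i a) < \<pi> (i b) \<longleftrightarrow> \<tau> a < \<tau> b"
  using assms by (auto simp: occurrence_def strict_mono_on_def image_subset_iff)

lemma Xi_contains_3412:
  assumes "{a, b, c, d} \<subseteq> {1..m}" "a < b" "b < c" "c < d"
    and "\<tau> c < \<tau> d" "\<tau> d < \<tau> a" "\<tau> a < \<tau> b"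
  shows "Xi m \<tau> = {r. r > 0}"
proof (intro equalityI subsetI)
  fix r :: nat assume "r \<in> {r. r > 0}"
  then have "r > 0" by simp
  then show "r \<in> Xi m \<tau>"
  proof (rule cyclic_arrangement_in_Xi[OF _ bij_betw_fold_back[of r]])
    fix k \<sigma> assume "k < r" and \<sigma>: "\<And>i. i < r \<Longrightarrow> \<sigma> (fold_back r i) = fold_back r ((i + k) mod r)"
    define same where "same i \<longleftrightarrow> (i < r div 2 \<longleftrightarrow> (i + k) mod r < r div 2)" for i
    have inc: "\<sigma> (fold_back r i) < \<sigma> (fold_back r j)"
      if "i < r" "j < r" "same i" "same j" "fold_back r i < fold_back r j" for i j
      using fold_back_shift_increasing[of i r j k] that \<open>k < r\<close> \<sigma> by (simp add: same_def)
    have dec: "\<sigma> (fold_back r j) < \<sigma> (fold_back r i)"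
      if "i < r" "j < r" "\<not> same i" "\<not> same j" "fold_back r i < fold_back r j" for i j
      using fold_back_shift_decreasing[of i r j k] that \<open>k < r\<close> \<sigma> by (auto simp: same_def)
    show "avoids r \<sigma> m \<tau>"
      unfolding avoids_def
    proof
      assume "\<exists>i. occurrence r \<sigma> m \<tau> i"
      then obtain i where occ: "occurrence r \<sigma> m \<tau> i" ..
      have "\<exists>u<r. i l = fold_back r u" if "l \<in> {a, b, c, d}" for l
      proof -
        have "i l \<in> fold_back r ` {..<r}"
          using bij_betw_fold_back[of r] occurrence_in_range[OF occ] assms(1) that
          by (auto simp: bij_betw_def)
        then show ?thesis by auto
      qed
      then obtain A B C D where idx: "A < r" "B < r" "C < r" "D < r"
        "i a = fold_back r A" "i b = fold_back r B" "i c = fold_back r C" "i d = fold_back r D"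
        by (meson insertCI)
      have pos: "i a < i b" "i b < i c" "i c < i d"
        using occurrence_less(1)[OF occ] assms(1-4) by auto
      have val: "\<sigma> (i c) < \<sigma> (i d)" "\<sigma> (i d) < \<sigma> (i a)" "\<sigma> (i a) < \<sigma> (i b)"
        using occurrence_less(2)[OF occ] assms(1,5-7) by auto
      \<comment> \<open>Both pairs are ascents, so neither can lie entirely in the decreasing
        part.\<close>
      have "same A \<or> same B" "same C \<or> same D"
        using dec[of A B] dec[of C D] pos val idx by auto
      \<comment> \<open>One staying point from each pair would form a descent inside the increasing
        part.\<close>
      then show False
        using inc[of A C] inc[of A D] inc[of B C] inc[of B D] pos val idx by auto
    qed
  qed
qed (simp add: Xi_def)

section \<open>Patterns occurring in rotations\<close>

lemma permutes_order_unique: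
  fixes \<sigma> \<tau> :: "nat \<Rightarrow> nat"
  assumes "\<sigma> permutes {1..m}" "\<tau> permutes {1..m}"
    and "\<And>j l. j \<in> {1..m} \<Longrightarrow> l \<in> {1..m} \<Longrightarrow> \<sigma> j < \<sigma> l \<longleftrightarrow> \<tau> j < \<tau> l"
  shows "\<sigma> = \<tau>"
proof
  \<comment> \<open>The value at j is its rank among all values, and ranks depend only on the
    relative order.\<close>
  have rank: "card {l \<in> {1..m}. \<rho> l \<le> \<rho> j} = \<rho> j" if "\<rho> permutes {1..m}" "j \<in> {1..m}" for \<rho> j
  proof -
    have "\<rho> ` {l \<in> {1..m}. \<rho> l \<le> \<rho> j} = {1..\<rho> j}"
    proof (intro equalityI subsetI)
      fix y assume y: "y \<in> {1..\<rho> j}"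
      moreover have "\<rho> j \<in> {1..m}"
        using permutes_in_image[OF that(1)] that(2) by blast
      ultimately have "y \<in> \<rho> ` {1..m}"
        using permutes_image[OF that(1)] by auto
      with y show "y \<in> \<rho> ` {l \<in> {1..m}. \<rho> l \<le> \<rho> j}" by auto
    qed (use permutes_in_image[OF that(1)] in fastforce)
    then show ?thesis
      using card_image[OF inj_on_subset[OF permutes_inj[OF that(1)]], of "{l \<in> {1..m}. \<rho> l \<le> \<rho> j}"]
      by simp
  qed
  fix j
  show "\<sigma> j = \<tau> j"
  proof (cases "j \<in> {1..m}")
    case True
    have "{l \<in> {1..m}. \<sigma> l \<le> \<sigma> j} = {l \<in> {1..m}. \<tau> l \<le> \<tau> j}"
      using assms(3)[OF True] by (auto simp: not_less[symmetric])
    then show ?thesis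
      using rank[OF assms(1) True] rank[OF assms(2) True] by simp
  next
    case False
    then show ?thesis
      using assms(1,2) by (simp add: permutes_not_in)
  qed
qed

lemma rotation_word_last_first:
  assumes "m \<ge> 2"
  shows "of_word (m # [1..<m]) permutes {1..m}"
    and "j \<in> {1..m} \<Longrightarrow> of_word (m # [1..<m]) j = (if j = 1 then m else j - 1)"
proof -
  have len: "length (m # [1..<m]) = m" using assms by simp
  have "set (m # [1..<m]) = {1..length (m # [1..<m])}"
    unfolding len using assms by auto
  from of_word_in_sym_group[OF _ this] show "of_word (m # [1..<m]) permutes {1..m}"
    unfolding len by (simp add: sym_group_carrier)
  show "j \<in> {1..m} \<Longrightarrow> of_word (m # [1..<m]) j = (if j = 1 then m else j - 1)"
    unfolding of_word_def len by (auto simp: nth_Cons')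
qed

lemma rotation_word_first_last:
  assumes "m \<ge> 2"
  shows "of_word ([2..<m + 1] @ [1]) permutes {1..m}"
    and "j \<in> {1..m} \<Longrightarrow> of_word ([2..<m + 1] @ [1]) j = (if j = m then 1 else j + 1)"
proof -
  have len: "length ([2..<m + 1] @ [1]) = m" using assms by simp
  have "set ([2..<m + 1] @ [1]) = {1..length ([2..<m + 1] @ [1])}"
    unfolding len using assms by auto
  from of_word_in_sym_group[OF _ this] show "of_word ([2..<m + 1] @ [1]) permutes {1..m}"
    unfolding len by (simp add: sym_group_carrier)
  show "j \<in> {1..m} \<Longrightarrow> of_word ([2..<m + 1] @ [1]) j = (if j = m then 1 else j + 1)"
    unfolding of_word_def len by (auto simp: nth_append simp del: upt_Suc)
qed

text \<open>The hypothesis on s describes two increasing blocks, positions up to s and positions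
  after s, with the first block above the second. So s determines \<open>\<tau>\<close>: the values
  0 and m, 1, and m-1 give the three exceptional words, and any other s leaves at least two entries
  in each block, hence a 3412.\<close>

lemma rotation_pattern_cases:
  assumes "m \<ge> 2" and \<tau>: "\<tau> permutes {1..m}" and "s \<le> m"
    and less_iff: "\<And>j l. j \<in> {1..m} \<Longrightarrow> l \<in> {1..m} \<Longrightarrow> j < l \<Longrightarrow> \<tau> j < \<tau> l \<longleftrightarrow> (j \<le> s \<longleftrightarrow> l \<le> s)"
  shows "\<tau> \<in> {id, of_word (m # [1..<m]), of_word ([2..<m + 1] @ [1])} \<or>
    (\<tau> (m - 1) < \<tau> m \<and> \<tau> m < \<tau> 1 \<and> \<tau> 1 < \<tau> 2 \<and> 2 < m - 1)"
proof -
  have eqI: "\<tau> = \<sigma>"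
    if "\<sigma> permutes {1..m}"
      "\<And>j l. j \<in> {1..m} \<Longrightarrow> l \<in> {1..m} \<Longrightarrow> j < l \<Longrightarrow> \<sigma> j < \<sigma> l \<longleftrightarrow> (j \<le> s \<longleftrightarrow> l \<le> s)" for \<sigma>
  proof (rule permutes_order_unique[OF \<tau> that(1)])
    fix j l assume jl: "j \<in> {1..m}" "l \<in> {1..m}"
    have "\<tau> j \<noteq> \<tau> l" "\<sigma> j \<noteq> \<sigma> l" if "j \<noteq> l"
      using that by (simp_all add: inj_eq[OF permutes_inj[OF \<tau>]]
          inj_eq[OF permutes_inj[OF \<open>\<sigma> permutes _\<close>]])
    then show "\<tau> j < \<tau> l \<longleftrightarrow> \<sigma> j < \<sigma> l"
      using jl less_iff[of j l] less_iff[of l j] that(2)[of j l] that(2)[of l j]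
      by (cases j l rule: linorder_cases) force+
  qed
  consider "s = 0 \<or> s = m" | "s = 1" | "s = m - 1" | "2 \<le> s" "s \<le> m - 2"
    using \<open>s \<le> m\<close> by linarith
  then show ?thesis
  proof cases
    case 1
    then have "\<tau> = id" by (intro eqI) (auto simp: permutes_id)
    then show ?thesis by simp
  next
    case 2
    have "\<tau> = of_word (m # [1..<m])"
      using 2 \<open>m \<ge> 2\<close> rotation_word_last_first[OF \<open>m \<ge> 2\<close>] by (intro eqI) auto
    then show ?thesis by simp
  next
    case 3
    have "\<tau> = of_word ([2..<m + 1] @ [1])"
      using 3 \<open>m \<ge> 2\<close> rotation_word_first_last[OF \<open>m \<ge> 2\<close>] by (intro eqI) auto
    then show ?thesis by simp
  next
    case 4
    \<comment> \<open>Needed to turn the failure of \<open>\<tau> 1 < \<tau> m\<close> into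
      \<open>\<tau> m < \<tau> 1\<close>.\<close>
    have "\<tau> 1 \<noteq> \<tau> m"
      using \<open>m \<ge> 2\<close> by (simp add: inj_eq[OF permutes_inj[OF \<tau>]])
    then show ?thesis
      using 4 less_iff[of 1 2] less_iff[of "m - 1" m] less_iff[of 1 m] by auto
  qed
qed

text \<open>The split is on 3412 at the two first and two last positions. If present, the folded
  cycle works whether or not \<open>\<tau>\<close> is a rotation; if absent,
  \<open>rotation_pattern_cases\<close> rules out every occurrence in a power of the plain
  cycle.\<close>

lemma Xi_generic:
  assumes "m \<ge> 2" and \<tau>: "\<tau> permutes {1..m}"
    and ne: "\<tau> \<notin> {id, of_word (m # [1..<m]), of_word ([2..<m + 1] @ [1])}"
  shows "Xi m \<tau> = {r. r > 0}"
proof (cases "\<tau> (m - 1) < \<tau> m \<and> \<tau> m < \<tau> 1 \<and> \<tau> 1 < \<tau> 2 \<and> 2 < m - 1")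
  case True
  then show ?thesis
    by (intro Xi_contains_3412[of 1 2 "m - 1" m]) auto
next
  case no3412: False
  show ?thesis
  proof (intro equalityI subsetI)
    fix r :: nat assume "r \<in> {r. r > 0}"
    then have "r > 0" by simp
    then show "r \<in> Xi m \<tau>"
    proof (rule cyclic_arrangement_in_Xi[where f = Suc])
      show "bij_betw Suc {..<r} {1..r}"
        by (simp add: bij_betw_def image_Suc_lessThan)
      fix k \<sigma> assume "k < r" and \<sigma>: "\<And>i. i < r \<Longrightarrow> \<sigma> (Suc i) = Suc ((i + k) mod r)"
      have \<sigma>': "\<sigma> p = (if p + k \<le> r then p + k else p + k - r)" if "p \<in> {1..r}" for p
        using \<sigma>[of "p - 1"] that \<open>k < r\<close> by (auto simp: mod_if)
      show "avoids r \<sigma> m \<tau>"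
        unfolding avoids_def
      proof
        assume "\<exists>i. occurrence r \<sigma> m \<tau> i"
        then obtain i where occ: "occurrence r \<sigma> m \<tau> i" ..
        \<comment> \<open>S collects the entries of the occurrence that the shift does not wrap
          around. It is an initial segment of \<open>{1..m}\<close> ending at s; inserting 0 makes s
          = 0 when S is empty.\<close>
        define S where "S = {j \<in> {1..m}. i j + k \<le> r}"
        define s where "s = Max (insert 0 S)"
        have [simp]: "finite S" by (simp add: S_def)
        have s: "j \<le> s \<longleftrightarrow> i j + k \<le> r" if j: "j \<in> {1..m}" for j
        proof
          assume "j \<le> s"
          then have "s \<in> S"
            using Max_in[of "insert 0 S"] j by (auto simp: s_def)
          moreover have "i j \<le> i s"
            using \<open>j \<le> s\<close> occurrence_less(1)[OF occ, of j s] j \<open>s \<in> S\<close>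
            by (cases "j = s") (auto simp: S_def)
          ultimately show "i j + k \<le> r" by (auto simp: S_def)
        next
          assume "i j + k \<le> r"
          then show "j \<le> s" using j by (auto simp: s_def S_def)
        qed
        have "s \<le> m" by (auto simp: s_def S_def)
        then have "\<tau> \<in> {id, of_word (m # [1..<m]), of_word ([2..<m + 1] @ [1])} \<or>
            (\<tau> (m - 1) < \<tau> m \<and> \<tau> m < \<tau> 1 \<and> \<tau> 1 < \<tau> 2 \<and> 2 < m - 1)"
        proof (rule rotation_pattern_cases[OF \<open>m \<ge> 2\<close> \<tau>])
          fix j l assume jl: "j \<in> {1..m}" "l \<in> {1..m}" "j < l"
          have "i j \<in> {1..r}" "i l \<in> {1..r}" "i j < i l"
            using occurrence_in_range[OF occ] occurrence_less(1)[OF occ] jl by auto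
          then have "\<sigma> (i j) < \<sigma> (i l) \<longleftrightarrow> (i j + k \<le> r \<longleftrightarrow> i l + k \<le> r)"
            using \<sigma>' \<open>k < r\<close> by auto
          then show "\<tau> j < \<tau> l \<longleftrightarrow> (j \<le> s \<longleftrightarrow> l \<le> s)"
            using occurrence_less(2)[OF occ] jl s by auto
        qed
        with ne no3412 show False by blast
      qed
    qed
  qed (simp add: Xi_def)
qed

section \<open>The patterns 231 and 312\<close>

lemma atLeastAtMost_1_3: "{1..3::nat} = {1, 2, 3}"
  by auto

lemma avoids_231D:
  assumes "avoids n \<pi> 3 (of_word [2, 3, 1])" "p < q" "q < s" "{p, q, s} \<subseteq> {1..n}"
  shows "\<not> (\<pi> s < \<pi> p \<and> \<pi> p < \<pi> q)"
proof
  assume "\<pi> s < \<pi> p \<and> \<pi> p < \<pi> q"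
  \<comment> \<open>Here \<open>of_word [p, q, s]\<close> serves as the position map sending 1, 2, 3
    to p, q, s; it need not be a permutation.\<close>
  then have "occurrence n \<pi> 3 (of_word [2, 3, 1]) (of_word [p, q, s])"
    using assms(2-4) unfolding occurrence_def atLeastAtMost_1_3
    by (auto simp: of_word_def strict_mono_on_def)
  with assms(1) show False by (auto simp: avoids_def)
qed

lemma avoids_312D:
  assumes "avoids n \<pi> 3 (of_word [3, 1, 2])" "p < q" "q < s" "{p, q, s} \<subseteq> {1..n}"
  shows "\<not> (\<pi> q < \<pi> s \<and> \<pi> s < \<pi> p)"
proof
  assume "\<pi> q < \<pi> s \<and> \<pi> s < \<pi> p"
  then have "occurrence n \<pi> 3 (of_word [3, 1, 2]) (of_word [p, q, s])"
    using assms(2-4) unfolding occurrence_def atLeastAtMost_1_3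
    by (auto simp: of_word_def strict_mono_on_def)
  with assms(1) show False by (auto simp: avoids_def)
qed

lemma avoids_231_312_involution:
  fixes \<pi> :: "nat \<Rightarrow> nat"
  assumes \<pi>: "\<pi> permutes {1..n}"
    and no231: "\<And>p q s. p < q \<Longrightarrow> q < s \<Longrightarrow> {p, q, s} \<subseteq> {1..n} \<Longrightarrow> \<not> (\<pi> s < \<pi> p \<and> \<pi> p < \<pi> q)"
    and no312: "\<And>p q s. p < q \<Longrightarrow> q < s \<Longrightarrow> {p, q, s} \<subseteq> {1..n} \<Longrightarrow> \<not> (\<pi> q < \<pi> s \<and> \<pi> s < \<pi> p)"
  shows "\<pi> (\<pi> x) = x"
proof -
  have inj: "\<pi> u = \<pi> v \<longleftrightarrow> u = v" for u v
    by (rule inj_eq[OF permutes_inj[OF \<pi>]])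
  have key: "c = \<pi> a" if "\<pi> c = a" "a < c" "a < \<pi> a" for a c
  proof -
    have in_range: "a \<in> {1..n}" "c \<in> {1..n}" "\<pi> a \<in> {1..n}"
      using that permutes_not_in[OF \<pi>] permutes_in_image[OF \<pi>] by (metis less_irrefl)+
    have "\<pi> ` {a<..<c} = {a<..<\<pi> a}"
    proof (intro equalityI subsetI)
      fix y assume "y \<in> \<pi> ` {a<..<c}"
      then obtain p where p: "a < p" "p < c" "y = \<pi> p" by auto
      then have "{a, p, c} \<subseteq> {1..n}" using in_range by auto
      \<comment> \<open>At positions a, p, c, a value of p above \<open>\<pi> a\<close> would create
        231, and one below a would create 312.\<close>
      then have "\<not> (\<pi> c < \<pi> a \<and> \<pi> a < \<pi> p)" "\<not> (\<pi> p < \<pi> c \<and> \<pi> c < \<pi> a)"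
        using no231[OF p(1,2)] no312[OF p(1,2)] by auto
      then show "y \<in> {a<..<\<pi> a}"
        using that p inj[of p a] inj[of p c] by auto
    next
      fix y assume y: "y \<in> {a<..<\<pi> a}"
      then have "y \<in> {1..n}" using in_range by auto
      then obtain p where p: "p \<in> {1..n}" "y = \<pi> p"
        using permutes_image[OF \<pi>] by blast
      \<comment> \<open>A preimage left of a would give 231 at p, a, c; one right of c would give
        312 at a, c, p.\<close>
      have "\<not> p < a"
        using no231[of p a c] p in_range that y by auto
      moreover have "\<not> c < p"
        using no312[of a c p] p in_range that y by auto
      moreover have "p \<noteq> a" "p \<noteq> c" using y p that by auto
      ultimately show "y \<in> \<pi> ` {a<..<c}" using p by auto
    qed
    then have "card {a<..<c} = card {a<..<\<pi> a}"
      using card_image[OF inj_on_subset[OF permutes_inj[OF \<pi>]], of "{a<..<c}"] by simp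
    then show ?thesis using that by simp
  qed
  define r where "r = group.ord (sym_group n) \<pi>"
  have r: "r > 0" "\<pi> ^^ r = id"
    using ord_sym_group_pos[OF \<pi>] funpow_ord_sym_group[OF \<pi>] by (simp_all add: r_def)
  \<comment> \<open>The minimum of the cycle through x; nonnegative powers reach the whole cycle
    since the order is finite.\<close>
  define a where "a = (LEAST y. \<exists>k. y = (\<pi> ^^ k) x)"
  obtain k where k: "a = (\<pi> ^^ k) x"
    unfolding a_def using LeastI_ex[of "\<lambda>y. \<exists>k. y = (\<pi> ^^ k) x"] by blast
  have least: "a \<le> (\<pi> ^^ j) x" for j
    unfolding a_def by (rule Least_le) blast
  \<comment> \<open>The predecessor of a on its cycle, again written with a nonnegative
    power.\<close>
  define c where "c = (\<pi> ^^ (r - 1 + k)) x"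
  have "\<pi> c = (\<pi> ^^ (r + k)) x"
    using r by (cases r) (simp_all add: c_def)
  also have "\<dots> = a"
    using r k by (simp add: funpow_add)
  finally have c: "\<pi> c = a" .
  have "\<pi> (\<pi> a) = a"
  proof (cases "\<pi> a = a")
    case False
    then have "a \<noteq> c" using c by auto
    then have "a < c" using least[of "r - 1 + k"] by (simp add: c_def)
    moreover have "a < \<pi> a" using least[of "Suc k"] False k by simp
    ultimately show ?thesis using key[OF c] c by simp
  qed simp
  \<comment> \<open>The equation is carried back from a to x, since \<open>\<pi> ^^ k\<close>
    commutes with \<open>\<pi>\<close> and is injective.\<close>
  then have "(\<pi> ^^ k) (\<pi> (\<pi> x)) = (\<pi> ^^ k) x"
    by (simp add: k funpow_swap1)
  moreover have "inj (\<pi> ^^ k)"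
    by (rule inj_fn[OF permutes_inj[OF \<pi>]])
  ultimately show ?thesis by (auto dest: injD)
qed

lemma inv_as_positive_power:
  fixes \<pi> :: "nat \<Rightarrow> nat"
  assumes "\<pi> permutes {1..n}"
  obtains j where "j \<ge> 1" "\<And>x. (\<pi> ^^ j) (\<pi> x) = x"
proof -
  define r where "r = group.ord (sym_group n) \<pi>"
  have r: "r > 0" "\<pi> ^^ r = id"
    using ord_sym_group_pos[OF assms] funpow_ord_sym_group[OF assms] by (simp_all add: r_def)
  \<comment> \<open>The exponent r - 1 would be 0 for r = 1, whereas 2r - 1 is always at least
    1.\<close>
  have "(\<pi> ^^ (r + r - 1)) (\<pi> x) = (\<pi> ^^ (r + r)) x" for x
    using r(1) by (metis Suc_diff_1 add_pos_pos comp_apply funpow_Suc_right)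
  also have "\<dots> x = x" for x
    using r(2) by (simp add: funpow_add)
  finally show thesis
    using r(1) by (intro that[of "r + r - 1"]) auto
qed

lemma Xi_three:
  assumes "\<tau> = of_word [2, 3, 1] \<or> \<tau> = of_word [3, 1, 2]"
  shows "Xi 3 \<tau> = {1, 2}"
proof (intro equalityI subsetI)
  fix r assume "r \<in> Xi 3 \<tau>"
  then obtain n \<pi> where \<pi>: "\<pi> permutes {1..n}" "group.ord (sym_group n) \<pi> = r"
      "\<And>j. j \<ge> 1 \<Longrightarrow> avoids n (\<pi> ^^ j) 3 \<tau>"
    by (auto simp: Xi_iff)
  obtain j where j: "j \<ge> 1" "\<And>x. (\<pi> ^^ j) (\<pi> x) = x"
    using inv_as_positive_power[OF \<pi>(1)] by blast
  have av: "avoids n \<pi> 3 \<tau>" "avoids n (\<pi> ^^ j) 3 \<tau>"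
    using \<pi>(3)[of 1] \<pi>(3)[OF j(1)] by simp_all
  have in_range: "{\<pi> p, \<pi> q, \<pi> s} \<subseteq> {1..n}" if "{p, q, s} \<subseteq> {1..n}" for p q s
    using that permutes_in_image[OF \<pi>(1)] by blast
  have "\<pi> (\<pi> x) = x" for x
  proof (rule avoids_231_312_involution[OF \<pi>(1)])
    fix p q s assume pqs: "p < q" "q < s" "{p, q, s} \<subseteq> {1..n}"
    show "\<not> (\<pi> s < \<pi> p \<and> \<pi> p < \<pi> q)"
      using assms
    proof
      assume \<tau>: "\<tau> = of_word [2, 3, 1]"
      show ?thesis using avoids_231D[OF av(1)[unfolded \<tau>] pqs] .
    next
      assume \<tau>: "\<tau> = of_word [3, 1, 2]"
      show ?thesis
        \<comment> \<open>A 231 in \<open>\<pi>\<close> becomes a 312 in its inverse when positions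
          and values are exchanged.\<close>
        using avoids_312D[OF av(2)[unfolded \<tau>], of "\<pi> s" "\<pi> p" "\<pi> q"] in_range[OF pqs(3)] j(2) pqs
        by auto
    qed
    show "\<not> (\<pi> q < \<pi> s \<and> \<pi> s < \<pi> p)"
      using assms
    proof
      assume \<tau>: "\<tau> = of_word [2, 3, 1]"
      show ?thesis
        using avoids_231D[OF av(2)[unfolded \<tau>], of "\<pi> q" "\<pi> s" "\<pi> p"] in_range[OF pqs(3)] j(2) pqs
        by auto
    next
      assume \<tau>: "\<tau> = of_word [3, 1, 2]"
      show ?thesis using avoids_312D[OF av(1)[unfolded \<tau>] pqs] .
    qed
  qed
  then have "\<pi> ^^ 2 = id"
    by (auto simp: numeral_2_eq_2)
  then have "r dvd 2"
    using ord_sym_group_eq_iff[OF \<pi>(1), of r] \<pi>(2) by blast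
  then have "r \<le> 2" by (rule dvd_imp_le) simp
  then show "r \<in> {1, 2}"
    using ord_sym_group_pos[OF \<pi>(1)] \<pi>(2) by auto
next
  fix r :: nat assume "r \<in> {1, 2}"
  then have r: "0 < r" "r < 3" by auto
  have "bij_betw Suc {..<r} {1..r}"
    by (simp add: bij_betw_def image_Suc_lessThan)
  \<comment> \<open>A cycle on one or two points has no room for a pattern of length 3.\<close>
  then show "r \<in> Xi 3 \<tau>"
    using r by (intro cyclic_arrangement_in_Xi[where f = Suc] avoids_longer) auto
qed

theorem theorem1p6:
  fixes m :: nat and \<tau> :: "nat \<Rightarrow> nat"
  assumes "m \<ge> 2" and "\<tau> \<in> carrier (sym_group m)"
  shows "(\<tau> = of_word [1..<m + 1] \<longrightarrow>
            Xi m \<tau> = group.ord (sym_group (m - 1)) ` carrier (sym_group (m - 1))) \<and>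
         (\<tau> \<notin> {of_word [1..<m + 1], of_word (m # [1..<m]), of_word ([2..<m + 1] @ [1])} \<longrightarrow>
            Xi m \<tau> = {r. r > 0}) \<and>
         Xi 3 (of_word [2, 3, 1]) = {1, 2} \<and>
         Xi 3 (of_word [3, 1, 2]) = {1, 2}"
  using Xi_id[OF assms(1)] Xi_generic[OF assms(1) assms(2)[unfolded sym_group_carrier]]
    Xi_three[of "of_word [2, 3, 1]"] Xi_three[of "of_word [3, 1, 2]"]
  unfolding of_word_upt by simp

end
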